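(* Let $\lambda=[\lambda_1,\ldots,\lambda_k]$ be a partition with frequency representation $[a_1,\ldots,a_{\lambda_1}]$, $n$ a positive integer, and $v$ a strictly increasing vector of length $k$ with entries in $\{1,\ldots,n\}$. Then the set of matrices in $P(v,\lambda,n)$ all of whose entries are nonnegative equals the transportation polytope $P_{(y,z)}$, where $y\in\mathbb{R}^{\lambda_1}$ has $y_i=a_{\lambda_1-i+1}$ for $1\le i\le\lambda_1$, and $z\in\mathbb{R}^n$ has $z_j=1$ if $j$ is an entry of $v$ and $z_j=0$ otherwise.
   Context: A partition is a weakly decreasing sequence of positive integers; $a_i$ is the number of parts equal to $i$. A sign matrix is a matrix with entries in $\{-1,0,1\}$ whose column partial sums from the top lie in $\{0,1\}$ and whose row partial sums from the left are nonnegative. $M(v,\lambda,n)$ is the set of $\lambda_1\times n$ sign matrices whose $i$-th row sums to $a_{\lambda_1-i+1}$ for all $i$ and whose $j$-th column sums to $1$ if $j$ is an entry of $v$ and $0$ otherwise; $P(v,\lambda,n)$ is its convex hull in $\mathbb{R}^{\lambda_1 n}$. For $y\in\mathbb{R}_{\ge0}^p$, $z\in\mathbb{R}_{\ge0}^q$, the transportation polytope $P_{(y,z)}$ is the set of real $p\times q$ matrices $X$ with all entries $X_{ij}\ge0$, $\sum_{j}X_{ij}=y_i$ for all $i$, and $\sum_i X_{ij}=z_j$ for all $j$. *)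

theory Defs
  imports "HOL-Analysis.Analysis" "HOL-Analysis.Finite_Function_Topology"
begin

text \<open>
  Partitions are lists of positive naturals, with parts numbered from \<open>1\<close> in the
  mathematics, so \<open>\<lambda>\<^sub>1\<close> is the head of the list. The empty partition is admitted, with the
  usual convention that its largest part is \<open>0\<close>.
\<close>

definition is_partition :: "nat list \<Rightarrow> bool" where
  "is_partition lam \<longleftrightarrow> sorted_wrt (\<ge>) lam \<and> (\<forall>x\<in>set lam. 0 < x)"

definition largest_part :: "nat list \<Rightarrow> nat" where
  "largest_part lam = (case lam of [] \<Rightarrow> 0 | x # _ \<Rightarrow> x)"

definition freq :: "nat list \<Rightarrow> nat \<Rightarrow> nat" where
  "freq lam i = count_list lam i"

text \<open>
  The numbers of rows and columns depend on \<open>\<lambda>\<close> and \<open>n\<close>, so \<open>p \<times> q\<close> matrices are not given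
  their own type. They are the finitely supported families indexed by pairs of naturals
  whose support lies in \<open>{1..p} \<times> {1..q}\<close>; this is a linear subspace isomorphic to
  \<open>\<real>\<^bsup>pq\<^esup>\<close>, and the library's convex hull applies. Rows and columns are numbered from \<open>1\<close>.
\<close>

type_synonym rmat = "(nat \<times> nat) \<Rightarrow>\<^sub>0 real"

abbreviation entry :: "rmat \<Rightarrow> nat \<Rightarrow> nat \<Rightarrow> real" where
  "entry X i j \<equiv> Poly_Mapping.lookup X (i, j)"

definition matrices :: "nat \<Rightarrow> nat \<Rightarrow> rmat set" where
  "matrices p q = {X. Poly_Mapping.keys X \<subseteq> {1..p} \<times> {1..q}}"

definition sign_matrices :: "nat \<Rightarrow> nat \<Rightarrow> rmat set" where
  "sign_matrices p q =
    {X \<in> matrices p q.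
      (\<forall>i\<in>{1..p}. \<forall>j\<in>{1..q}. entry X i j \<in> {-1, 0, 1}) \<and>
      (\<forall>i\<in>{1..p}. \<forall>j\<in>{1..q}. (\<Sum>i'=1..i. entry X i' j) \<in> {0, 1}) \<and>
      (\<forall>i\<in>{1..p}. \<forall>j\<in>{1..q}. 0 \<le> (\<Sum>j'=1..j. entry X i j'))}"

definition M_set :: "nat list \<Rightarrow> nat list \<Rightarrow> nat \<Rightarrow> rmat set" where
  "M_set v lam n =
    {X \<in> sign_matrices (largest_part lam) n.
      (\<forall>i\<in>{1..largest_part lam}.
         (\<Sum>j=1..n. entry X i j) = real (freq lam (largest_part lam - i + 1))) \<and>
      (\<forall>j\<in>{1..n}.
         (\<Sum>i=1..largest_part lam. entry X i j) = (if j \<in> set v then 1 else 0))}"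

definition P_polytope :: "nat list \<Rightarrow> nat list \<Rightarrow> nat \<Rightarrow> rmat set" where
  "P_polytope v lam n = convex hull (M_set v lam n)"

text \<open>
  Of the margins \<open>y\<close> and \<open>z\<close> only the values \<open>y 1, \<dots>, y p\<close> and \<open>z 1, \<dots>, z q\<close> matter.
\<close>

definition transportation_polytope ::
  "nat \<Rightarrow> nat \<Rightarrow> (nat \<Rightarrow> real) \<Rightarrow> (nat \<Rightarrow> real) \<Rightarrow> rmat set" where
  "transportation_polytope p q y z =
    {X \<in> matrices p q.
      (\<forall>i\<in>{1..p}. \<forall>j\<in>{1..q}. 0 \<le> entry X i j) \<and>
      (\<forall>i\<in>{1..p}. (\<Sum>j=1..q. entry X i j) = y i) \<and>
      (\<forall>j\<in>{1..q}. (\<Sum>i=1..p. entry X i j) = z j)}"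

end

theory Submission
  imports Defs
begin

text \<open>
  The point is that a transportation polytope with integer margins is the convex hull of its
  integer points. If a point \<open>X\<close> has a non-integer entry, integrality of the margins gives every
  row and column containing such an entry at least two of them, so there are at least as many
  fractional entries as there are rows and columns involved. A dimension count then yields a
  nonzero \<open>D\<close> with zero margins supported on the fractional entries. Moving from \<open>X\<close> along \<open>D\<close>
  and along \<open>-D\<close> until some entry becomes an integer exhibits \<open>X\<close> as a convex combination of two
  points with fewer fractional entries. When all column sums are \<open>0\<close> or \<open>1\<close>, the integer points are
  sign matrices.
\<close>

section \<open>Zero-margin matrices supported on a given set of cells\<close>

lemma lookup_scaleR [simp]: "Poly_Mapping.lookup (r *\<^sub>R f) k = r *\<^sub>R Poly_Mapping.lookup f k"
proof -
  have "finite {k. r *\<^sub>R Poly_Mapping.lookup f k \<noteq> 0}"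
    by (rule finite_subset[OF _ finite_lookup[of f]]) auto
  then show ?thesis
    by (simp add: scaleR_poly_mapping_def)
qed

text \<open>Each cell \<open>(i, j)\<close> is encoded as \<open>u (i, j)\<close>, the unit vector
  of its row plus the unit vector of its column. A linear relation among these vectors with
  coefficients \<open>d\<close> says, coordinate by coordinate, that every row and column sum of
  \<open>d\<close> vanishes, so linear dependence of the vectors is all that has to be
  found.\<close>

lemma zero_margin_perturbation:
  fixes F :: "('a \<times> 'b) set"
  assumes F: "F \<noteq> {}" "F \<subseteq> A \<times> B" and AB: "finite A" "finite B"
    and rows: "\<And>i j. (i, j) \<in> F \<Longrightarrow> \<exists>j'. j' \<noteq> j \<and> (i, j') \<in> F"
    and cols: "\<And>i j. (i, j) \<in> F \<Longrightarrow> \<exists>i'. i' \<noteq> i \<and> (i', j) \<in> F"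
  obtains d :: "'a \<times> 'b \<Rightarrow> real"
  where "\<exists>k\<in>F. d k \<noteq> 0" "\<And>k. k \<notin> F \<Longrightarrow> d k = 0"
    "\<And>i. i \<in> A \<Longrightarrow> (\<Sum>j\<in>B. d (i, j)) = 0" "\<And>j. j \<in> B \<Longrightarrow> (\<Sum>i\<in>A. d (i, j)) = 0"
proof -
  define R C where "R = fst ` F" and "C = snd ` F"
  have finF: "finite F"
    using F AB by (meson finite_SigmaI finite_subset)
  then have finRC: "finite R" "finite C"
    by (auto simp: R_def C_def)
  have two: "2 \<le> card S" if "finite S" "x \<in> S" "y \<in> S" "x \<noteq> y" for S :: "'c set" and x y
    using card_mono[of S "{x, y}"] that by auto
  \<comment> \<open>Counting the cells of \<open>F\<close> by rows here and by columns below gives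
    two bounds whose sum is \<open>card R + card C \<le> card F\<close>.\<close>
  have "2 * card R = (\<Sum>i\<in>R. 2)"
    by simp
  also have "\<dots> \<le> (\<Sum>i\<in>R. card (F `` {i}))"
  proof (rule sum_mono)
    fix i assume "i \<in> R"
    then obtain j where j: "(i, j) \<in> F"
      by (auto simp: R_def)
    then obtain j' where "j' \<noteq> j" "(i, j') \<in> F"
      using rows by blast
    moreover have "finite (F `` {i})"
      using finF by (rule finite_Image)
    ultimately show "2 \<le> card (F `` {i})"
      using j by (intro two[of _ j j']) auto
  qed
  also have "\<dots> = card (SIGMA i:R. F `` {i})"
    using finRC finF by (intro card_SigmaI[symmetric]) (auto intro: finite_Image)
  also have "(SIGMA i:R. F `` {i}) = F"
    by (force simp: R_def)
  finally have cR: "2 * card R \<le> card F" .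
  have "2 * card C = (\<Sum>j\<in>C. 2)"
    by simp
  also have "\<dots> \<le> (\<Sum>j\<in>C. card (F\<inverse> `` {j}))"
  proof (rule sum_mono)
    fix j assume "j \<in> C"
    then obtain i where i: "(i, j) \<in> F"
      by (auto simp: C_def)
    then obtain i' where "i' \<noteq> i" "(i', j) \<in> F"
      using cols by blast
    moreover have "finite (F\<inverse> `` {j})"
      using finF by (simp add: finite_Image)
    ultimately show "2 \<le> card (F\<inverse> `` {j})"
      using i by (intro two[of _ i i']) auto
  qed
  also have "\<dots> = card (SIGMA j:C. F\<inverse> `` {j})"
    using finRC finF by (intro card_SigmaI[symmetric]) (auto intro: finite_Image)
  also have "(SIGMA j:C. F\<inverse> `` {j}) = F\<inverse>"
    by (force simp: C_def)
  finally have cC: "2 * card C \<le> card F"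
    by simp
  define r :: "'a \<Rightarrow> ('a + 'b) \<Rightarrow>\<^sub>0 real" where "r i = Poly_Mapping.single (Inl i) 1" for i
  define c :: "'b \<Rightarrow> ('a + 'b) \<Rightarrow>\<^sub>0 real" where "c j = Poly_Mapping.single (Inr j) 1" for j
  define u where "u k = r (fst k) + c (snd k)" for k
  have lookup_u: "Poly_Mapping.lookup (u k) (Inl i) = of_bool (fst k = i)"
    "Poly_Mapping.lookup (u k) (Inr j) = of_bool (snd k = j)" for k i j
    by (auto simp: u_def r_def c_def lookup_add lookup_single when_def)
  \<comment> \<open>Dependence is a property of sets of vectors. Injectivity ensures that the image
    has as many elements as \<open>F\<close> and that its coefficients pull back to cells.\<close>
  have inj: "inj_on u F"
  proof (rule inj_onI)
    fix k l assume "u k = u l"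
    then have "Poly_Mapping.lookup (u k) (Inl (fst k)) = Poly_Mapping.lookup (u l) (Inl (fst k))"
      "Poly_Mapping.lookup (u k) (Inr (snd k)) = Poly_Mapping.lookup (u l) (Inr (snd k))"
      by simp_all
    then show "k = l"
      by (auto simp: lookup_u prod_eq_iff)
  qed
  obtain i0 where i0: "i0 \<in> R"
    using F by (auto simp: R_def)
  \<comment> \<open>The vectors \<open>u k\<close> have equal row and column weight, so they span at most
    \<open>card R + card C - 1\<close> dimensions.\<close>
  define T where "T = (\<lambda>j. r i0 + c j) ` C \<union> (\<lambda>i. r i - r i0) ` (R - {i0})"
  have "card T \<le> card C + card (R - {i0})"
    unfolding T_def
    by (intro order_trans[OF card_Un_le] add_mono card_image_le) (use finRC in auto)
  moreover have "card (R - {i0}) < card R"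
    using finRC i0 by (intro psubset_card_mono) auto
  ultimately have cT: "card T < card F"
    using cR cC by linarith
  have finT: "finite T"
    using finRC by (simp add: T_def)
  have "u ` F \<subseteq> span T"
  proof (clarify)
    fix i j assume ij: "(i, j) \<in> F"
    have "r i0 + c j \<in> span T"
      using ij by (force simp: T_def C_def intro!: span_base)
    moreover have "r i - r i0 \<in> span T"
    proof (cases "i = i0")
      case False
      then show ?thesis
        using ij by (force simp: T_def R_def intro!: span_base)
    qed (simp add: span_zero)
    ultimately have "(r i0 + c j) + (r i - r i0) \<in> span T"
      by (rule span_add)
    then show "u (i, j) \<in> span T"
      by (simp add: u_def algebra_simps)
  qed
  then have "dependent (u ` F)"
    using independent_span_bound[OF finT, of "u ` F"] cT card_image[OF inj] by auto
  then obtain w where w: "\<exists>x\<in>u ` F. w x \<noteq> 0" "(\<Sum>x\<in>u ` F. w x *\<^sub>R x) = 0"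
    using dependent_finite[of "u ` F"] finF by auto
  define d where "d k = (if k \<in> F then w (u k) else 0)" for k
  have "(\<Sum>k\<in>F. d k *\<^sub>R u k) = 0"
    using w(2) by (simp add: sum.reindex[OF inj] d_def cong: sum.cong)
  then have "Poly_Mapping.lookup (\<Sum>k\<in>F. d k *\<^sub>R u k) x = 0" for x
    by simp
  then have lk: "(\<Sum>k\<in>F. d k * Poly_Mapping.lookup (u k) x) = 0" for x
    by (simp add: lookup_sum)
  \<comment> \<open>Since \<open>d\<close> vanishes off \<open>F\<close>, the relation may be summed
    over the whole grid. Taking a coordinate of \<open>u\<close> for \<open>f\<close> then isolates
    one row or column sum.\<close>
  have ext: "(\<Sum>k\<in>F. d k * f k) = (\<Sum>i\<in>A. \<Sum>j\<in>B. d (i, j) * f (i, j))" for f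
    unfolding sum.cartesian_product
    by (rule sum.mono_neutral_cong_left) (use F AB in \<open>auto simp: d_def\<close>)
  show thesis
  proof
    show "\<exists>k\<in>F. d k \<noteq> 0"
      using w(1) by (auto simp: d_def)
    show "d k = 0" if "k \<notin> F" for k
      using that by (simp add: d_def)
    show "(\<Sum>j\<in>B. d (i, j)) = 0" if "i \<in> A" for i
    proof -
      have "(\<Sum>i'\<in>A. \<Sum>j\<in>B. d (i', j) * of_bool (i' = i)) = (\<Sum>i'\<in>A. if i' = i then (\<Sum>j\<in>B. d (i', j)) else 0)"
        by (intro sum.cong) auto
      then show ?thesis
        using lk[of "Inl i"] ext[of "\<lambda>k. Poly_Mapping.lookup (u k) (Inl i)"] that AB by (simp add: lookup_u)
    qed
    show "(\<Sum>i\<in>A. d (i, j)) = 0" if "j \<in> B" for j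
    proof -
      have "(\<Sum>i\<in>A. \<Sum>j'\<in>B. d (i, j') * of_bool (j' = j)) = (\<Sum>i\<in>A. \<Sum>j'\<in>B. if j' = j then d (i, j') else 0)"
        by (intro sum.cong) auto
      then show ?thesis
        using lk[of "Inr j"] ext[of "\<lambda>k. Poly_Mapping.lookup (u k) (Inr j)"] that AB by (simp add: lookup_u)
    qed
  qed
qed

text \<open>If all other summands were integers, subtracting them from the integer total would leave
  an integer \<open>f x\<close>. In a row or column this supplies the second fractional cell that
  \<open>zero_margin_perturbation\<close> asks for.\<close>

lemma another_fractional_summand:
  fixes f :: "'a \<Rightarrow> real"
  assumes "finite S" "sum f S \<in> \<int>" "x \<in> S" "f x \<notin> \<int>"
  shows "\<exists>y\<in>S. y \<noteq> x \<and> f y \<notin> \<int>"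
proof (rule ccontr)
  assume "\<not> ?thesis"
  then have "sum f (S - {x}) \<in> \<int>"
    by (intro Ints_sum) auto
  then have "sum f S - sum f (S - {x}) \<in> \<int>"
    using assms by (intro Ints_diff)
  then show False
    using assms by (simp add: sum.remove)
qed

section \<open>Fractional entries and integral points of transportation polytopes\<close>

definition fractional_cells :: "rmat \<Rightarrow> (nat \<times> nat) set" where
  "fractional_cells X = {k. Poly_Mapping.lookup X k \<notin> \<int>}"

lemma fractional_cells_subset_keys: "fractional_cells X \<subseteq> Poly_Mapping.keys X"
  by (auto simp: fractional_cells_def in_keys_iff)

lemma finite_fractional_cells: "finite (fractional_cells X)"
  using fractional_cells_subset_keys by (rule finite_subset) simp

lemma transportation_polytope_nonneg:
  assumes "X \<in> transportation_polytope p q y z"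
  shows "0 \<le> Poly_Mapping.lookup X k"
proof (cases "k \<in> {1..p} \<times> {1..q}")
  case True
  then show ?thesis
    using assms by (auto simp: transportation_polytope_def)
next
  case False
  then have "k \<notin> Poly_Mapping.keys X"
    using assms by (auto simp: transportation_polytope_def matrices_def)
  then show ?thesis
    by (simp add: in_keys_iff)
qed

text \<open>Adding a multiple of \<open>D\<close> never changes the margins. Stopping when the first
  moving entry meets an integer keeps all entries nonnegative and makes that entry integral, while
  integral entries do not move because \<open>D\<close> lives on fractional cells.\<close>

lemma transportation_polytope_step:
  assumes X: "X \<in> transportation_polytope p q y z"
    and D: "D \<noteq> 0" "Poly_Mapping.keys D \<subseteq> fractional_cells X"
    and D_rows: "\<And>i. i \<in> {1..p} \<Longrightarrow> (\<Sum>j=1..q. entry D i j) = 0"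
    and D_cols: "\<And>j. j \<in> {1..q} \<Longrightarrow> (\<Sum>i=1..p. entry D i j) = 0"
  obtains t where "0 < t" "X + t *\<^sub>R D \<in> transportation_polytope p q y z"
    "fractional_cells (X + t *\<^sub>R D) \<subset> fractional_cells X"
proof -
  let ?x = "Poly_Mapping.lookup X" and ?d = "Poly_Mapping.lookup D"
  define K where "K = Poly_Mapping.keys D"
  have K: "finite K" "K \<noteq> {}"
    using D by (auto simp: K_def)
  \<comment> \<open>The first integer that entry \<open>k\<close> meets along \<open>D\<close>,
    above it or below it according to the sign of \<open>?d k\<close>; \<tau> gives the time of
    arrival.\<close>
  define target :: "nat \<times> nat \<Rightarrow> int" where "target k = (if 0 < ?d k then \<lceil>?x k\<rceil> else \<lfloor>?x k\<rfloor>)" for k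
  define \<tau> where "\<tau> k = (real_of_int (target k) - ?x k) / ?d k" for k
  have frac: "real_of_int \<lfloor>?x k\<rfloor> < ?x k" "?x k < real_of_int \<lceil>?x k\<rceil>" if "k \<in> K" for k
  proof -
    have "?x k \<notin> \<int>"
      using that D by (auto simp: K_def fractional_cells_def)
    then show "real_of_int \<lfloor>?x k\<rfloor> < ?x k" "?x k < real_of_int \<lceil>?x k\<rceil>"
      by (metis Ints_of_int less_eq_real_def of_int_floor_le, metis Ints_of_int less_eq_real_def le_of_int_ceiling)
  qed
  have d_nz: "?d k \<noteq> 0" if "k \<in> K" for k
    using that by (simp add: K_def in_keys_iff)
  \<comment> \<open>Moving entries are fractional, hence strictly away from their targets at time
    0.\<close>
  have \<tau>_pos: "0 < \<tau> k" if "k \<in> K" for k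
    using frac[OF that] d_nz[OF that] by (auto simp: \<tau>_def target_def zero_less_divide_iff)
  define t where "t = Min (\<tau> ` K)"
  have t_le: "t \<le> \<tau> k" if "k \<in> K" for k
    using that K by (simp add: t_def)
  have t_pos: "0 < t"
    using K \<tau>_pos by (simp add: t_def)
  have "t \<in> \<tau> ` K"
    unfolding t_def using K by (intro Min_in) auto
  then obtain m where m: "m \<in> K" "t = \<tau> m"
    by blast
  let ?Y = "X + t *\<^sub>R D"
  have lookup_Y: "Poly_Mapping.lookup ?Y k = ?x k + t * ?d k" for k
    by (simp add: lookup_add)
  \<comment> \<open>Only decreasing entries are at risk. By minimality of \<open>t\<close> they stay
    at or above the floor of their starting value, which is itself nonnegative.\<close>
  have "0 \<le> ?x k + t * ?d k" for k
  proof (cases "k \<in> K \<and> ?d k < 0")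
    case True
    then have "t * ?d k \<ge> \<tau> k * ?d k"
      using t_le by (intro mult_right_mono_neg) auto
    moreover have "\<tau> k * ?d k = real_of_int \<lfloor>?x k\<rfloor> - ?x k"
      using True by (simp add: \<tau>_def target_def)
    moreover have "0 \<le> real_of_int \<lfloor>?x k\<rfloor>"
      using transportation_polytope_nonneg[OF X, of k] by simp
    ultimately show ?thesis
      by linarith
  next
    case False
    then have "0 \<le> ?d k"
      by (auto simp: K_def in_keys_iff not_less)
    then show ?thesis
      using t_pos transportation_polytope_nonneg[OF X, of k] by simp
  qed
  moreover have "?Y \<in> matrices p q"
  proof -
    have "Poly_Mapping.keys ?Y \<subseteq> Poly_Mapping.keys X"
    proof
      fix k assume "k \<in> Poly_Mapping.keys ?Y"
      then have "k \<in> Poly_Mapping.keys X \<or> k \<in> Poly_Mapping.keys D"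
        by (auto simp: in_keys_iff lookup_Y)
      then show "k \<in> Poly_Mapping.keys X"
        using D(2) fractional_cells_subset_keys by blast
    qed
    then show ?thesis
      using X by (auto simp: transportation_polytope_def matrices_def)
  qed
  ultimately have "?Y \<in> transportation_polytope p q y z"
    using X D_rows D_cols
    by (simp add: transportation_polytope_def lookup_Y sum.distrib flip: sum_distrib_left)
  moreover have "fractional_cells ?Y \<subset> fractional_cells X"
  proof (rule psubsetI)
    show "fractional_cells ?Y \<subseteq> fractional_cells X"
    proof
      fix k assume k: "k \<in> fractional_cells ?Y"
      show "k \<in> fractional_cells X"
      proof (cases "k \<in> K")
        case False
        then show ?thesis
          using k by (simp add: fractional_cells_def lookup_Y K_def in_keys_iff)
      qed (use D in \<open>auto simp: K_def\<close>)
    qed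
    \<comment> \<open>The entry attaining the minimum lands exactly on its target, which makes the
      inclusion strict.\<close>
    have "?x m + t * ?d m = real_of_int (target m)"
      using m d_nz by (simp add: \<tau>_def)
    then have "m \<notin> fractional_cells ?Y"
      by (simp add: fractional_cells_def lookup_Y)
    moreover have "m \<in> fractional_cells X"
      using m D by (auto simp: K_def)
    ultimately show "fractional_cells ?Y \<noteq> fractional_cells X"
      by blast
  qed
  ultimately show thesis
    using that t_pos by blast
qed

theorem transportation_polytope_integral:
  assumes X: "X \<in> transportation_polytope p q y z"
    and y: "\<And>i. i \<in> {1..p} \<Longrightarrow> y i \<in> \<int>" and z: "\<And>j. j \<in> {1..q} \<Longrightarrow> z j \<in> \<int>"
  shows "X \<in> convex hull {Y \<in> transportation_polytope p q y z. fractional_cells Y = {}}"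
    (is "_ \<in> convex hull ?I")
  using finite_fractional_cells[of X] X
proof (induction "fractional_cells X" arbitrary: X rule: finite_psubset_induct)
  case psubset
  show ?case
  proof (cases "fractional_cells X = {}")
    case True
    then show ?thesis
      using psubset.prems by (simp add: hull_inc)
  next
    case False
    have box: "fractional_cells X \<subseteq> {1..p} \<times> {1..q}"
      using fractional_cells_subset_keys[of X] psubset.prems
      by (auto simp: transportation_polytope_def matrices_def)
    have rows: "(\<Sum>j=1..q. entry X i j) \<in> \<int>" if "i \<in> {1..p}" for i
      using psubset.prems y[OF that] that by (simp add: transportation_polytope_def)
    have cols: "(\<Sum>i=1..p. entry X i j) \<in> \<int>" if "j \<in> {1..q}" for j
      using psubset.prems z[OF that] that by (simp add: transportation_polytope_def)
    obtain d where d: "\<exists>k\<in>fractional_cells X. d k \<noteq> (0::real)"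
      "\<And>k. k \<notin> fractional_cells X \<Longrightarrow> d k = 0"
      "\<And>i. i \<in> {1..p} \<Longrightarrow> (\<Sum>j=1..q. d (i, j)) = 0"
      "\<And>j. j \<in> {1..q} \<Longrightarrow> (\<Sum>i=1..p. d (i, j)) = 0"
    proof (rule zero_margin_perturbation[OF False box])
      fix i j assume ij: "(i, j) \<in> fractional_cells X"
      then have box_ij: "i \<in> {1..p}" "j \<in> {1..q}" and frac: "entry X i j \<notin> \<int>"
        using box by (auto simp: fractional_cells_def)
      show "\<exists>j'. j' \<noteq> j \<and> (i, j') \<in> fractional_cells X"
        using another_fractional_summand[OF _ rows[OF box_ij(1)] box_ij(2) frac]
        unfolding fractional_cells_def by blast
      show "\<exists>i'. i' \<noteq> i \<and> (i', j) \<in> fractional_cells X"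
        using another_fractional_summand[OF _ cols[OF box_ij(2)] box_ij(1) frac]
        unfolding fractional_cells_def by blast
    qed auto
    define D where "D = Abs_poly_mapping d"
    have "finite {k. d k \<noteq> 0}"
      using d(2) by (intro finite_subset[OF _ finite_fractional_cells[of X]]) auto
    then have lookup_D: "Poly_Mapping.lookup D = d"
      by (simp add: D_def)
    have D: "D \<noteq> 0" "Poly_Mapping.keys D \<subseteq> fractional_cells X"
      using d(1,2) by (auto simp: lookup_D[symmetric] in_keys_iff)
    obtain s where s: "0 < s" "X + s *\<^sub>R D \<in> transportation_polytope p q y z"
      "fractional_cells (X + s *\<^sub>R D) \<subset> fractional_cells X"
      by (rule transportation_polytope_step[OF psubset.prems D]) (use d lookup_D in auto)
    \<comment> \<open>The step moves only forwards, so the opposite direction is obtained from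
      \<open>- D\<close>, which has the same support and also zero margins.\<close>
    obtain t where t: "0 < t" "X + t *\<^sub>R (- D) \<in> transportation_polytope p q y z"
      "fractional_cells (X + t *\<^sub>R (- D)) \<subset> fractional_cells X"
      by (rule transportation_polytope_step[OF psubset.prems, of "- D"])
        (use D d lookup_D in \<open>auto simp: sum_negf\<close>)
    have "X + s *\<^sub>R D \<in> convex hull ?I" "X + t *\<^sub>R (- D) \<in> convex hull ?I"
      using psubset.hyps s t by blast+
    \<comment> \<open>The weights are inversely proportional to the distances \<open>s\<close> and
      \<open>t\<close> travelled, so the two contributions of \<open>D\<close> cancel.\<close>
    moreover have weights: "t / (s + t) + s / (s + t) = 1"
      using s(1) t(1) by (simp add: add.commute flip: add_divide_distrib)
    ultimately have "(t / (s + t)) *\<^sub>R (X + s *\<^sub>R D) + (s / (s + t)) *\<^sub>R (X + t *\<^sub>R (- D)) \<in> convex hull ?I"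
      using s(1) t(1) by (intro convexD[OF convex_convex_hull]) auto
    also have "(t / (s + t)) *\<^sub>R (X + s *\<^sub>R D) + (s / (s + t)) *\<^sub>R (X + t *\<^sub>R (- D)) =
        (t / (s + t) + s / (s + t)) *\<^sub>R X"
      by (simp add: scaleR_add_left scaleR_diff_right scaleR_add_right mult.commute)
    finally show ?thesis
      by (simp add: weights)
  qed
qed

section \<open>Integral points as sign matrices, and margins on convex hulls\<close>

text \<open>Entries and column partial sums are integers between 0 and the column total, which is at
  most 1. Row partial sums are nonnegative because the entries are.\<close>

lemma integral_transportation_in_sign_matrices:
  assumes X: "X \<in> transportation_polytope p q y z" "fractional_cells X = {}"
    and z: "\<And>j. j \<in> {1..q} \<Longrightarrow> z j \<in> {0, 1}"
  shows "X \<in> sign_matrices p q"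
proof -
  have nonneg: "0 \<le> entry X i j" for i j
    using X(1) by (rule transportation_polytope_nonneg)
  have int: "entry X i j \<in> \<int>" for i j
    using X(2) by (auto simp: fractional_cells_def)
  have zero_one: "s \<in> {0, 1}" if "s \<in> \<int>" "0 \<le> s" "s \<le> z j" "j \<in> {1..q}" for s j
  proof -
    from \<open>s \<in> \<int>\<close> obtain a where "s = of_int a"
      by (rule Ints_cases)
    then show ?thesis
      using that z[OF that(4)] by auto
  qed
  have col: "(\<Sum>i=1..p. entry X i j) = z j" if "j \<in> {1..q}" for j
    using X that by (simp add: transportation_polytope_def)
  have "(\<Sum>i'=1..i. entry X i' j) \<in> {0, 1}" "entry X i j \<in> {0, 1}"
    if "i \<in> {1..p}" "j \<in> {1..q}" for i j
  proof -
    have "(\<Sum>i'=1..i. entry X i' j) \<le> z j"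
      unfolding col[OF that(2), symmetric] using that nonneg by (intro sum_mono2) auto
    then show "(\<Sum>i'=1..i. entry X i' j) \<in> {0, 1}"
      using that(2) by (intro zero_one) (auto intro: Ints_sum sum_nonneg int nonneg)
    have "entry X i j \<le> z j"
      unfolding col[OF that(2), symmetric] using that nonneg by (intro member_le_sum) auto
    then show "entry X i j \<in> {0, 1}"
      using that(2) by (intro zero_one) (auto intro: int nonneg)
  qed
  then show ?thesis
    using X(1) nonneg unfolding sign_matrices_def
    by (auto simp: transportation_polytope_def intro: sum_nonneg)
qed

text \<open>This carries the margins of \<open>M_set\<close> over to its hull. Nonnegativity is left
  out, since sign matrices may have entries -1.\<close>

lemma convex_fixed_margins:
  "convex {X \<in> matrices p q. (\<forall>i\<in>{1..p}. (\<Sum>j=1..q. entry X i j) = y i) \<and>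
    (\<forall>j\<in>{1..q}. (\<Sum>i=1..p. entry X i j) = z j)}" (is "convex ?S")
proof (rule convexI)
  fix X Y :: rmat and s t :: real
  assume XY: "X \<in> ?S" "Y \<in> ?S" and st: "s + t = 1"
  have affine: "s * a + t * a = a" for a
    using st by (metis distrib_right mult_1)
  have "Poly_Mapping.keys (s *\<^sub>R X + t *\<^sub>R Y) \<subseteq> Poly_Mapping.keys X \<union> Poly_Mapping.keys Y"
    by (auto simp: in_keys_iff lookup_add)
  then have "s *\<^sub>R X + t *\<^sub>R Y \<in> matrices p q"
    using XY unfolding matrices_def by blast
  then show "s *\<^sub>R X + t *\<^sub>R Y \<in> ?S"
    using XY by (simp add: lookup_add sum.distrib affine flip: sum_distrib_left)
qed

theorem theorem9p12:
  fixes lam v :: "nat list" and n :: nat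
  assumes "is_partition lam"
    and "0 < n"
    and "sorted_wrt (<) v"
    and "length v = length lam"
    and "set v \<subseteq> {1..n}"
  shows "{X \<in> P_polytope v lam n.
            \<forall>i\<in>{1..largest_part lam}. \<forall>j\<in>{1..n}. 0 \<le> entry X i j} =
         transportation_polytope (largest_part lam) n
           (\<lambda>i. real (freq lam (largest_part lam - i + 1)))
           (\<lambda>j. if j \<in> set v then 1 else 0)"
    (is "?L = transportation_polytope ?p n ?y ?z")
proof (intro equalityI subsetI)
  fix X assume X: "X \<in> ?L"
  \<comment> \<open>The hull inherits support and margins from its generators; nonnegativity comes
    from membership in \<open>?L\<close>.\<close>
  have "P_polytope v lam n \<subseteq> {X \<in> matrices ?p n.
      (\<forall>i\<in>{1..?p}. (\<Sum>j=1..n. entry X i j) = ?y i) \<and>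
      (\<forall>j\<in>{1..n}. (\<Sum>i=1..?p. entry X i j) = ?z j)}"
    unfolding P_polytope_def
    by (intro hull_minimal convex_fixed_margins) (auto simp: M_set_def sign_matrices_def)
  then show "X \<in> transportation_polytope ?p n ?y ?z"
    using X by (auto simp: transportation_polytope_def)
next
  fix X assume X: "X \<in> transportation_polytope ?p n ?y ?z"
  then have "X \<in> convex hull {Y \<in> transportation_polytope ?p n ?y ?z. fractional_cells Y = {}}"
    by (rule transportation_polytope_integral) auto
  \<comment> \<open>The integral points already have the margins required by \<open>M_set\<close>,
    and their column totals are 0 or 1, so they are among the generators of the hull.\<close>
  moreover have "{Y \<in> transportation_polytope ?p n ?y ?z. fractional_cells Y = {}} \<subseteq> M_set v lam n"
    using integral_transportation_in_sign_matrices[of _ ?p n ?y ?z]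
    by (auto simp: M_set_def transportation_polytope_def)
  ultimately have "X \<in> P_polytope v lam n"
    unfolding P_polytope_def using hull_mono by blast
  then show "X \<in> ?L"
    using X transportation_polytope_nonneg[OF X] by simp
qed

end
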